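(* Let $(X,d)$ be a metric space. Then $X$ admits a coarse embedding into a Hilbert space if and only if there exist a normalized, negative definite kernel $N$ on $X$ and non-decreasing functions $\rho_1,\rho_2\colon [0,\infty)\to[0,\infty)$ satisfying (1) $\rho_1(d(x,y))\le N(x,y)\le \rho_2(d(x,y))$ for all $x,y\in X$; (2) $\lim_{t\to\infty}\rho_1(t)=\infty$.
   Context: A (not necessarily continuous) map $f\colon X\to Y$ between metric spaces $(X,d_X)$ and $(Y,d_Y)$ is a coarse embedding if there exist non-decreasing functions $\sigma_1,\sigma_2\colon[0,\infty)\to[0,\infty)$ such that $\sigma_1(d_X(x,y))\le d_Y(f(x),f(y))\le\sigma_2(d_X(x,y))$ for all $x,y\in X$ and $\lim_{t\to\infty}\sigma_1(t)=+\infty$. All Hilbert spaces are real (and not necessarily separable). A kernel on a set $X$ is a symmetric function $K\colon X\times X\to\mathbb{R}$. A kernel $K$ is negative definite if $\sum_{i,j=1}^n K(x_i,x_j)c_ic_j\le 0$ for all $n\in\mathbb{N}$, $x_1,\dots,x_n\in X$ and $c_1,\dots,c_n\in\mathbb{R}$ with $\sum_{i=1}^n c_i=0$. A negative definite kernel $K$ is normalized if $K(x,x)=0$ for all $x\in X$. *)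

theory Defs
  imports "HOL-Analysis.Analysis" "HOL-Algebra.Module"
begin

definition control_function :: "(real \<Rightarrow> real) \<Rightarrow> bool" where
  "control_function \<rho> \<longleftrightarrow> \<rho> \<in> {0..} \<rightarrow> {0..} \<and> mono_on {0..} \<rho>"

definition coarse_embedding ::
    "'a set \<Rightarrow> ('a \<Rightarrow> 'a \<Rightarrow> real) \<Rightarrow> 'b set \<Rightarrow> ('b \<Rightarrow> 'b \<Rightarrow> real) \<Rightarrow> ('a \<Rightarrow> 'b) \<Rightarrow> bool" where
  "coarse_embedding X dX Y dY f \<longleftrightarrow>
     f \<in> X \<rightarrow> Y \<and>
     (\<exists>\<sigma>1 \<sigma>2. control_function \<sigma>1 \<and> control_function \<sigma>2 \<and>
        (\<forall>x\<in>X. \<forall>y\<in>X. \<sigma>1 (dX x y) \<le> dY (f x) (f y) \<and> dY (f x) (f y) \<le> \<sigma>2 (dX x y)) \<and>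
        filterlim \<sigma>1 at_top at_top)"

definition kernel_on :: "'a set \<Rightarrow> ('a \<Rightarrow> 'a \<Rightarrow> real) \<Rightarrow> bool" where
  "kernel_on X K \<longleftrightarrow> (\<forall>x\<in>X. \<forall>y\<in>X. K x y = K y x)"

definition negative_definite_kernel :: "'a set \<Rightarrow> ('a \<Rightarrow> 'a \<Rightarrow> real) \<Rightarrow> bool" where
  "negative_definite_kernel X K \<longleftrightarrow>
     kernel_on X K \<and>
     (\<forall>n (x :: nat \<Rightarrow> 'a) (c :: nat \<Rightarrow> real).
        x \<in> {..<n} \<rightarrow> X \<and> (\<Sum>i<n. c i) = 0 \<longrightarrow>
        (\<Sum>i<n. \<Sum>j<n. K (x i) (x j) * c i * c j) \<le> 0)"

definition normalized_kernel :: "'a set \<Rightarrow> ('a \<Rightarrow> 'a \<Rightarrow> real) \<Rightarrow> bool" where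
  "normalized_kernel X K \<longleftrightarrow> (\<forall>x\<in>X. K x x = 0)"

text \<open>
  The existential over Hilbert spaces in the theorem ranges over structures with an explicit carrier,
  because HOL has no quantifier over the types of class \<open>{real_inner, complete_space}\<close>.
  The vector space part is a module over the field of reals; the fields \<open>mult\<close> and \<open>one\<close>
  that the record inherits from \<open>ring\<close> are ignored.
\<close>

definition real_ring :: "real ring" where
  "real_ring = \<lparr>carrier = UNIV, mult = (*), one = 1, zero = 0, add = (+)\<rparr>"

record 'h inner_space = "(real, 'h) module" +
  ip :: "'h \<Rightarrow> 'h \<Rightarrow> real"

locale real_inner_space = module real_ring H for H :: "('h, 'm) inner_space_scheme" (structure) +
  assumes ip_commute: "\<lbrakk>x \<in> carrier H; y \<in> carrier H\<rbrakk> \<Longrightarrow> ip H x y = ip H y x"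
    and ip_add_left: "\<lbrakk>x \<in> carrier H; y \<in> carrier H; z \<in> carrier H\<rbrakk> \<Longrightarrow>
          ip H (x \<oplus> y) z = ip H x z + ip H y z"
    and ip_smult_left: "\<lbrakk>x \<in> carrier H; y \<in> carrier H\<rbrakk> \<Longrightarrow> ip H (a \<odot> x) y = a * ip H x y"
    and ip_nonneg: "x \<in> carrier H \<Longrightarrow> 0 \<le> ip H x x"
    and ip_eq_zeroD: "\<lbrakk>x \<in> carrier H; ip H x x = 0\<rbrakk> \<Longrightarrow> x = \<zero>"

text \<open>
  The value 0 off the carrier is needed because the locale \<open>Metric_space\<close> asks for
  nonnegativity and symmetry on the whole type.
\<close>

definition ip_dist :: "('h, 'm) inner_space_scheme \<Rightarrow> 'h \<Rightarrow> 'h \<Rightarrow> real" where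
  "ip_dist H x y =
     (if x \<in> carrier H \<and> y \<in> carrier H
      then sqrt (ip H (x \<ominus>\<^bsub>H\<^esub> y) (x \<ominus>\<^bsub>H\<^esub> y)) else 0)"

locale real_hilbert_space = real_inner_space +
  assumes complete: "Metric_space.mcomplete (carrier H) (ip_dist H)"

context real_inner_space
begin

lemma real_ring_simps [simp]:
  "carrier real_ring = UNIV" "a \<oplus>\<^bsub>real_ring\<^esub> b = a + b" "a \<otimes>\<^bsub>real_ring\<^esub> b = a * b"
  "\<one>\<^bsub>real_ring\<^esub> = 1" "\<zero>\<^bsub>real_ring\<^esub> = 0"
  by (simp_all add: real_ring_def)

lemma smult_closed_real [simp]: "x \<in> carrier H \<Longrightarrow> a \<odot> x \<in> carrier H"
  using smult_closed[of a x] by simp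

lemma ip_add_right:
  "\<lbrakk>x \<in> carrier H; y \<in> carrier H; z \<in> carrier H\<rbrakk> \<Longrightarrow> ip H z (x \<oplus> y) = ip H z x + ip H z y"
  using ip_add_left[of x y z] by (simp add: ip_commute[of z])

lemma ip_smult_right:
  "\<lbrakk>x \<in> carrier H; y \<in> carrier H\<rbrakk> \<Longrightarrow> ip H y (a \<odot> x) = a * ip H y x"
  using ip_smult_left[of x y a] by (simp add: ip_commute[of y])

lemma ip_zero [simp]: "ip H \<zero> \<zero> = 0"
  using ip_add_left[of \<zero> \<zero> \<zero>] by simp

lemma ip_zero_left [simp]: "y \<in> carrier H \<Longrightarrow> ip H \<zero> y = 0"
  using ip_add_left[of \<zero> \<zero> y] by simp

lemma ip_neg_left:
  "\<lbrakk>x \<in> carrier H; y \<in> carrier H\<rbrakk> \<Longrightarrow> ip H (\<ominus> x) y = - ip H x y"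
  using ip_add_left[of x "\<ominus> x" y] by (simp add: M.r_neg)

lemma ip_neg_neg:
  "x \<in> carrier H \<Longrightarrow> ip H (\<ominus> x) (\<ominus> x) = ip H x x"
  by (simp add: ip_neg_left ip_commute[of x "\<ominus> x"])

lemma ip_quadratic:
  assumes "x \<in> carrier H" "y \<in> carrier H"
  shows "ip H ((a \<odot> x) \<oplus> (b \<odot> y)) ((a \<odot> x) \<oplus> (b \<odot> y)) =
         a\<^sup>2 * ip H x x + 2 * a * b * ip H x y + b\<^sup>2 * ip H y y"
  using assms ip_commute[of y x]
  by (simp add: ip_add_left ip_add_right ip_smult_left ip_smult_right algebra_simps power2_eq_square)

lemma Cauchy_Schwarz:
  assumes x: "x \<in> carrier H" and y: "y \<in> carrier H"
  shows "ip H x y \<le> sqrt (ip H x x) * sqrt (ip H y y)"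
proof -
  let ?p = "sqrt (ip H x x)" and ?q = "sqrt (ip H y y)"
  have p: "?p\<^sup>2 = ip H x x" "?p \<ge> 0" and q: "?q\<^sup>2 = ip H y y" "?q \<ge> 0"
    using x y by (simp_all add: ip_nonneg)
  have id: "q\<^sup>2 * p\<^sup>2 + 2 * q * (- p) * r + (- p)\<^sup>2 * q\<^sup>2 = 2 * (p * q) * (p * q - r)"
    for p q r :: real
    by (simp add: algebra_simps power2_eq_square)
  have zero: "ip H x y \<le> ?p * ?q" if "?p = 0 \<or> ?q = 0"
  proof -
    have "x = \<zero> \<or> y = \<zero>"
      using that x y by (auto intro: ip_eq_zeroD)
    then show ?thesis
      using x y ip_commute[of x y] by auto
  qed
  have "0 \<le> ?q\<^sup>2 * ip H x x + 2 * ?q * (- ?p) * ip H x y + (- ?p)\<^sup>2 * ip H y y"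
    unfolding ip_quadratic[OF x y, symmetric] using x y by (intro ip_nonneg) simp
  also have "\<dots> = ?q\<^sup>2 * ?p\<^sup>2 + 2 * ?q * (- ?p) * ip H x y + (- ?p)\<^sup>2 * ?q\<^sup>2"
    by (simp only: p(1) q(1))
  also have "\<dots> = 2 * (?p * ?q) * (?p * ?q - ip H x y)"
    using id[of ?q ?p "ip H x y"] .
  finally have "0 \<le> 2 * (?p * ?q) * (?p * ?q - ip H x y)" .
  moreover have "0 < ?p * ?q" if "\<not> (?p = 0 \<or> ?q = 0)"
    using that p(2) q(2) by (intro mult_pos_pos) linarith+
  ultimately show ?thesis
    using zero by (smt (verit) zero_le_mult_iff)
qed

lemma Metric_space_ip_dist: "Metric_space (carrier H) (ip_dist H)"
proof
  fix x y z
  show "0 \<le> ip_dist H x y"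
    by (auto simp: ip_dist_def ip_nonneg)
  show "ip_dist H x y = ip_dist H y x"
  proof (cases "x \<in> carrier H \<and> y \<in> carrier H")
    case True
    then have "\<ominus> (x \<ominus> y) = y \<ominus> x"
      by (simp add: a_minus_def M.minus_add M.a_comm)
    then show ?thesis
      using True ip_neg_neg[of "x \<ominus> y"] by (simp add: ip_dist_def)
  qed (auto simp: ip_dist_def)
  assume x: "x \<in> carrier H" and y: "y \<in> carrier H"
  have minus_eq_zero: "x \<ominus> y = \<zero> \<longleftrightarrow> x = y"
    using x y M.r_neg M.minus_equality[of x "\<ominus> y"] by (auto simp: a_minus_def)
  show "ip_dist H x y = 0 \<longleftrightarrow> x = y"
    using x y ip_eq_zeroD[of "x \<ominus> y"] minus_eq_zero
    by (auto simp: ip_dist_def)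
  assume z: "z \<in> carrier H"
  let ?u = "x \<ominus> y" and ?v = "y \<ominus> z"
  have uv: "?u \<in> carrier H" "?v \<in> carrier H" using x y z by auto
  have eq: "x \<ominus> z = ?u \<oplus> ?v"
    using x y z by (simp add: a_minus_def M.a_assoc M.r_neg1)
  have "ip H (x \<ominus> z) (x \<ominus> z) = ip H ?u ?u + 2 * ip H ?u ?v + ip H ?v ?v"
    using uv ip_commute[of ?v ?u] by (simp add: eq ip_add_left ip_add_right)
  also have "\<dots> \<le> (sqrt (ip H ?u ?u) + sqrt (ip H ?v ?v))\<^sup>2"
    using Cauchy_Schwarz[OF uv] uv by (simp add: power2_sum ip_nonneg)
  finally show "ip_dist H x z \<le> ip_dist H x y + ip_dist H y z"
    using x y z uv by (simp add: ip_dist_def real_le_lsqrt ip_nonneg)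
qed

end

definition hilbert_of_class :: "'h :: {real_inner, complete_space} inner_space" where
  "hilbert_of_class =
     \<lparr>carrier = UNIV, mult = (\<lambda>x y. 0), one = 0, zero = 0, add = (+), smult = (*\<^sub>R), ip = (\<bullet>)\<rparr>"

lemma ip_dist_hilbert_of_class:
  "ip_dist (hilbert_of_class :: 'h :: {real_inner, complete_space} inner_space) = dist"
proof -
  have ab: "abelian_group (hilbert_of_class :: 'h inner_space)"
    by (rule abelian_groupI)
       (auto simp: hilbert_of_class_def algebra_simps intro: exI[of _ "- x" for x])
  then interpret abelian_group "hilbert_of_class :: 'h inner_space" .
  have "\<ominus>\<^bsub>hilbert_of_class\<^esub> y = - y" for y :: 'h
    by (rule minus_equality) (auto simp: hilbert_of_class_def)
  then show ?thesis
    by (auto simp: fun_eq_iff ip_dist_def a_minus_def hilbert_of_class_def dist_norm norm_eq_sqrt_inner)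
qed

lemma real_hilbert_space_hilbert_of_class:
  "real_hilbert_space (hilbert_of_class :: 'h :: {real_inner, complete_space} inner_space)"
proof -
  let ?H = "hilbert_of_class :: 'h inner_space"
  have "real_inner_space ?H"
  proof (intro real_inner_space.intro moduleI)
    show "cring real_ring"
      by (intro cringI abelian_groupI comm_monoidI)
         (auto simp: real_ring_def algebra_simps intro: exI[of _ "- x" for x])
    show "abelian_group ?H"
      by (rule abelian_groupI)
         (auto simp: hilbert_of_class_def algebra_simps intro: exI[of _ "- x" for x])
    show "real_inner_space_axioms ?H"
      by unfold_locales (auto simp: hilbert_of_class_def inner_add_left intro: inner_commute)
  qed (auto simp: hilbert_of_class_def real_ring_def algebra_simps)
  moreover have "Metric_space.mcomplete (carrier ?H) (ip_dist ?H)"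
    unfolding ip_dist_hilbert_of_class
    using complete_UNIV[where 'a = 'h] by (simp add: hilbert_of_class_def)
  ultimately show ?thesis
    by (simp add: real_hilbert_space_def real_hilbert_space_axioms_def)
qed

text \<open>
  The elements of the Hilbert space are drawn from \<open>'h\<close>. For \<open>X :: 'a set\<close>, taking
  \<open>'h = ('a \<Rightarrow> real)\<close> loses nothing: the closed linear span of the image of \<open>X\<close> has Hilbert
  dimension at most the cardinality of \<open>X\<close>, hence is isometric to a space of real functions on
  \<open>X\<close>. The theorem does not presuppose this: its second conjunct asserts that an
  embedding into a Hilbert space over an arbitrary type yields one over \<open>'a \<Rightarrow> real\<close>.
\<close>

definition coarsely_embeds_in_hilbert ::
    "'h itself \<Rightarrow> 'a set \<Rightarrow> ('a \<Rightarrow> 'a \<Rightarrow> real) \<Rightarrow> bool" where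
  "coarsely_embeds_in_hilbert (_ :: 'h itself) X d \<longleftrightarrow>
     (\<exists>(H :: 'h inner_space) f. real_hilbert_space H \<and>
        coarse_embedding X d (carrier H) (ip_dist H) f)"

end

theory Submission
  imports Defs "HOL-Library.Function_Algebras"
begin

text \<open>
  Squared distances in a real inner product space are negative definite: for points \<open>v\<^sub>i\<close> and
  coefficients \<open>c\<^sub>i\<close> of sum zero, expanding \<open>\<parallel>v\<^sub>i - v\<^sub>j\<parallel>\<^sup>2\<close> leaves only the mixed terms, and
  \<open>\<Sum> c\<^sub>i c\<^sub>j \<parallel>v\<^sub>i - v\<^sub>j\<parallel>\<^sup>2 = -2 \<parallel>\<Sum> c\<^sub>i v\<^sub>i\<parallel>\<^sup>2\<close> (\<open>negative_definite_squared_distance\<close>). Conversely,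
  by Schoenberg, a normalized negative definite kernel \<open>N\<close> is the squared distance of a map into a
  Hilbert space (\<open>negative_definite_kernel_embeds\<close>). So a coarse embedding and a controlled kernel are
  the same thing up to replacing the control functions by their squares or square roots.

  For Schoenberg's direction a base point \<open>p\<close> turns \<open>N\<close> into the positive semidefinite kernel
  \<open>K x y = (N x p + N p y - N x y) / 2\<close>, for which \<open>K x x + K y y - 2 K x y = N x y\<close>. Hence it
  suffices to find a Hilbert space with vectors of Gram matrix \<open>K\<close>, and the reproducing kernel
  Hilbert space of \<open>K\<close> is one. Its elements are real functions on \<open>X\<close>, which is the reason
  that \<open>'a \<Rightarrow> real\<close> is a large enough type to hold all the Hilbert spaces that matter: an
  embedding into a Hilbert space over any other type is first turned into a kernel and then into an
  embedding over \<open>'a \<Rightarrow> real\<close>.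

  The reproducing kernel Hilbert space is built here without completing a span. In a Hilbert space
  \<open>\<parallel>f\<parallel>\<^sup>2\<close> is the supremum of \<open>2\<langle>f,u\<rangle> - \<parallel>u\<parallel>\<^sup>2\<close> over a dense set of vectors \<open>u\<close>. For \<open>u = \<Sum> c\<^sub>i K(x\<^sub>i,-)\<close>
  the reproducing property makes this the expression \<open>2 \<Sum> c\<^sub>i f(x\<^sub>i) - \<Sum> c\<^sub>i c\<^sub>j K(x\<^sub>i,x\<^sub>j)\<close>, which
  makes sense for every function \<open>f\<close>. The space consists of the functions for which the supremum is
  finite. Three facts then give a Hilbert space. The parallelogram law for each pair of
  combinations passes to the suprema, and the Jordan--von Neumann theorem turns it into an inner
  product. A bound on point evaluations makes norm-Cauchy sequences converge
  pointwise. Finally, a supremum of functionals that each depend on finitely many values is lower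
  semicontinuous under pointwise convergence, so the pointwise limit is a limit in norm.
\<close>

section \<open>Quadratic forms satisfying the parallelogram law\<close>

text \<open>
  Subtracting the linear function with the same value at 1 leaves an additive function that vanishes
  on the integers. It is therefore periodic, hence bounded everywhere, and a bounded additive function is
  zero because its values at multiples grow proportionally.
\<close>

lemma bounded_additive_imp_linear:
  fixes h :: "real \<Rightarrow> real"
  assumes add: "\<And>s t. h (s + t) = h s + h t"
    and bound: "\<And>t. 0 \<le> t \<Longrightarrow> t \<le> 1 \<Longrightarrow> \<bar>h t\<bar> \<le> C"
  shows "h t = t * h 1"
proof -
  define g where "g t = h t - t * h 1" for t
  have g_add: "g (s + t) = g s + g t" for s t
    by (simp add: g_def add algebra_simps)
  have g0: "g 0 = 0" using g_add[of 0 0] by simp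
  have g_minus: "g (- t) = - g t" for t using g_add[of t "- t"] g0 by simp
  have g_mult: "g (real n * t) = real n * g t" for n t
    by (induction n) (simp_all add: g0 g_add algebra_simps)
  have g_nat: "g (real n) = 0" for n
    using g_mult[of n 1] by (simp add: g_def)
  have g_int: "g (of_int k) = 0" for k
    by (cases k rule: int_cases2) (simp_all add: g_nat g_minus)
  define D where "D = C + \<bar>h 1\<bar>"
  have g_bound: "\<bar>g t\<bar> \<le> D" for t
  proof -
    have "\<bar>frac t * h 1\<bar> \<le> \<bar>h 1\<bar>"
      using frac_lt_1[of t] by (simp add: abs_mult mult_left_le_one_le)
    moreover have "\<bar>h (frac t)\<bar> \<le> C"
      using frac_lt_1[of t] by (intro bound) auto
    ultimately have "\<bar>g (frac t)\<bar> \<le> D"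
      unfolding g_def D_def by linarith
    moreover have "g t = g (frac t)"
      using g_add[of "of_int \<lfloor>t\<rfloor>" "frac t"] by (simp add: g_int frac_def)
    ultimately show ?thesis by simp
  qed
  have "g t = 0"
  proof (rule ccontr)
    assume "g t \<noteq> 0"
    then obtain n where "D < real n * \<bar>g t\<bar>"
      using reals_Archimedean3[of "\<bar>g t\<bar>"] by auto
    also have "\<dots> = \<bar>g (real n * t)\<bar>" by (simp add: g_mult abs_mult)
    also have "\<dots> \<le> D" by (rule g_bound)
    finally show False by simp
  qed
  then show ?thesis by (simp add: g_def)
qed

text \<open>
  The setting of the Jordan--von Neumann theorem, with the squared norm \<open>Q\<close> as the primitive notion;
  the triangle inequality comes out as a consequence of the inner product.
\<close>

locale parallelogram_space =
  fixes V :: "'v :: real_vector set" and Q :: "'v \<Rightarrow> real"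
  assumes V: "subspace V"
    and Q_nonneg: "u \<in> V \<Longrightarrow> 0 \<le> Q u"
    and Q_scale: "u \<in> V \<Longrightarrow> Q (t *\<^sub>R u) = t\<^sup>2 * Q u"
    and parallelogram: "\<lbrakk>u \<in> V; v \<in> V\<rbrakk> \<Longrightarrow> Q (u + v) + Q (u - v) = 2 * Q u + 2 * Q v"
    and Q_eq_zeroD: "\<lbrakk>u \<in> V; Q u = 0\<rbrakk> \<Longrightarrow> u = 0"
begin

definition polar :: "'v \<Rightarrow> 'v \<Rightarrow> real" where
  "polar u v = (Q (u + v) - Q (u - v)) / 4"

lemmas V_closed [simp, intro] =
  subspace_0[OF V] subspace_add[OF V] subspace_diff[OF V] subspace_scale[OF V] subspace_neg[OF V]

lemma Q_minus: "u \<in> V \<Longrightarrow> Q (- u) = Q u"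
  using Q_scale[of u "-1"] by simp

lemma polar_self: "u \<in> V \<Longrightarrow> polar u u = Q u"
  using Q_scale[of u 2] Q_scale[of 0 0] by (simp add: polar_def scaleR_2)

lemma polar_commute: "\<lbrakk>u \<in> V; v \<in> V\<rbrakk> \<Longrightarrow> polar u v = polar v u"
  using Q_minus[of "u - v"] by (simp add: polar_def add.commute)

text \<open>
  The parallelogram law at \<open>x + w\<close>, \<open>y\<close> and at \<open>y + w\<close>, \<open>x\<close>, for \<open>w = z\<close> and for \<open>w = -z\<close>, gives four
  identities. In their alternating sum the terms with \<open>x - y\<close> cancel in pairs because \<open>Q\<close> is even.
\<close>

lemma polar_add_left:
  assumes "x \<in> V" "y \<in> V" "z \<in> V"
  shows "polar (x + y) z = polar x z + polar y z"
proof -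
  have shift: "Q (x + y + w) + Q (x - y + w) = 2 * Q (x + w) + 2 * Q y"
    if "x \<in> V" "y \<in> V" "w \<in> V" for x y w
    using parallelogram[of "x + w" y] that by (simp add: algebra_simps)
  have "Q (x - y + z) = Q (y - x + (- z))" "Q (y - x + z) = Q (x - y + (- z))"
    using Q_minus[of "x - y + z"] Q_minus[of "y - x + z"] assms by (simp_all add: algebra_simps)
  then show ?thesis
    using shift[of x y z] shift[of y x z] shift[of x y "- z"] shift[of y x "- z"] assms
    by (simp add: polar_def add.commute[of y x] field_simps)
qed

text \<open>
  Additivity alone gives homogeneity only over the rationals. Nonnegativity of \<open>Q\<close> supplies the
  missing regularity: it bounds the polar form along a segment.
\<close>

lemma polar_scale_left:
  assumes "x \<in> V" "y \<in> V"
  shows "polar (t *\<^sub>R x) y = t * polar x y"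
proof -
  let ?h = "\<lambda>t. polar (t *\<^sub>R x) y"
  have "?h t = t * ?h 1"
  proof (rule bounded_additive_imp_linear[where C = "Q x + Q y"])
    show "?h (s + t) = ?h s + ?h t" for s t
      using assms by (simp add: scaleR_add_left polar_add_left)
    fix s :: real assume s: "0 \<le> s" "s \<le> 1"
    let ?a = "Q (s *\<^sub>R x + y)" and ?b = "Q (s *\<^sub>R x - y)"
    have "?a + ?b = 2 * (s\<^sup>2 * Q x) + 2 * Q y"
      using parallelogram[of "s *\<^sub>R x" y] assms by (simp add: Q_scale)
    also have "s\<^sup>2 * Q x \<le> Q x"
      using s assms by (simp add: mult_left_le_one_le Q_nonneg power_le_one)
    finally have "?a + ?b \<le> 2 * Q x + 2 * Q y" by simp
    moreover have "0 \<le> ?a" "0 \<le> ?b" "0 \<le> Q x" "0 \<le> Q y" using assms by (auto intro: Q_nonneg)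
    ultimately show "\<bar>?h s\<bar> \<le> Q x + Q y" by (simp add: polar_def)
  qed
  then show ?thesis by simp
qed

definition inner_structure :: "'v inner_space" where
  "inner_structure =
     \<lparr>carrier = V, mult = (\<lambda>x y. 0), one = 0, zero = 0, add = (+), smult = (*\<^sub>R), ip = polar\<rparr>"

lemma inner_structure_simps [simp]:
  "carrier inner_structure = V" "add inner_structure = (+)" "zero inner_structure = 0"
  "smult inner_structure = (*\<^sub>R)" "ip inner_structure = polar"
  by (simp_all add: inner_structure_def)

lemma real_inner_space_inner_structure: "real_inner_space inner_structure"
proof (intro real_inner_space.intro moduleI)
  show "cring real_ring"
    by (intro cringI abelian_groupI comm_monoidI)
       (auto simp: real_ring_def algebra_simps intro: exI[of _ "- x" for x])
  show "abelian_group inner_structure"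
    by (rule abelian_groupI) (auto simp: algebra_simps intro: bexI[of _ "- x" for x])
  show "real_inner_space_axioms inner_structure"
    by unfold_locales
       (auto simp: polar_add_left polar_scale_left polar_self Q_nonneg Q_eq_zeroD intro: polar_commute)
qed (auto simp: real_ring_def algebra_simps)

lemma ip_dist_inner_structure:
  assumes "u \<in> V" "v \<in> V"
  shows "ip_dist inner_structure u v = sqrt (Q (u - v))"
proof -
  interpret real_inner_space inner_structure by (rule real_inner_space_inner_structure)
  have "\<ominus>\<^bsub>inner_structure\<^esub> v = - v"
    using assms by (intro M.minus_equality) auto
  then show ?thesis
    using assms by (simp add: ip_dist_def a_minus_def polar_self)
qed

end

section \<open>Finitely supported combinations of points\<close>

text \<open>
  Pointwise scalar multiplication makes both the coefficient functions and the elements of the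
  Hilbert space below into vectors, so that the preceding section applies to a set of functions.
\<close>

instantiation "fun" :: (type, real_vector) real_vector
begin

definition scaleR_fun :: "real \<Rightarrow> ('a \<Rightarrow> 'b) \<Rightarrow> 'a \<Rightarrow> 'b" where
  "scaleR_fun t f = (\<lambda>x. t *\<^sub>R f x)"

instance
  by standard (simp_all add: scaleR_fun_def fun_eq_iff scaleR_add_left scaleR_add_right)

end

lemma scaleR_fun_apply [simp]: "(t *\<^sub>R f) x = t *\<^sub>R f x"
  by (simp add: scaleR_fun_def)

text \<open>
  Formal finite linear combinations of points of \<open>X\<close>, encoded by their coefficients. They form
  a vector space, which lists of points with coefficients do not.
\<close>
definition combinations :: "'a set \<Rightarrow> ('a \<Rightarrow> real) set" where
  "combinations X = {c. finite {x. c x \<noteq> 0} \<and> {x. c x \<noteq> 0} \<subseteq> X}"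

text \<open>
  The extension of \<open>f\<close> from points to formal combinations by linearity.
\<close>
definition pairing :: "('a \<Rightarrow> real) \<Rightarrow> ('a \<Rightarrow> real) \<Rightarrow> real" where
  "pairing c f = (\<Sum>x | c x \<noteq> 0. c x * f x)"

definition kernel_form :: "('a \<Rightarrow> 'a \<Rightarrow> real) \<Rightarrow> ('a \<Rightarrow> real) \<Rightarrow> ('a \<Rightarrow> real) \<Rightarrow> real" where
  "kernel_form K c e = pairing c (\<lambda>x. pairing e (K x))"

definition point_mass :: "'a \<Rightarrow> 'a \<Rightarrow> real" where
  "point_mass x = (\<lambda>y. if y = x then 1 else 0)"

lemma subspace_combinations: "subspace (combinations X)"
proof (rule subspaceI)
  fix c e :: "'a \<Rightarrow> real" assume "c \<in> combinations X" "e \<in> combinations X"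
  moreover have "{x. (c + e) x \<noteq> 0} \<subseteq> {x. c x \<noteq> 0} \<union> {x. e x \<noteq> 0}" by auto
  ultimately show "c + e \<in> combinations X"
    unfolding combinations_def by (blast intro: finite_subset)
next
  fix t and c :: "'a \<Rightarrow> real" assume "c \<in> combinations X"
  moreover have "{x. (t *\<^sub>R c) x \<noteq> 0} \<subseteq> {x. c x \<noteq> 0}" by auto
  ultimately show "t *\<^sub>R c \<in> combinations X"
    unfolding combinations_def by (blast intro: finite_subset)
qed (simp add: combinations_def)

lemmas combinations_closed [simp, intro] =
  subspace_0[OF subspace_combinations] subspace_add[OF subspace_combinations]
  subspace_diff[OF subspace_combinations] subspace_scale[OF subspace_combinations]

lemma point_mass_in_combinations [simp]: "x \<in> X \<Longrightarrow> point_mass x \<in> combinations X"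
  by (auto simp: combinations_def point_mass_def)

lemma pairing_superset:
  assumes "finite F" "{x. c x \<noteq> 0} \<subseteq> F"
  shows "pairing c f = (\<Sum>x\<in>F. c x * f x)"
  unfolding pairing_def using assms by (intro sum.mono_neutral_left) auto

lemma pairing_point_mass [simp]: "pairing (point_mass x) f = f x"
  using pairing_superset[of "{x}" "point_mass x" f] by (auto simp: point_mass_def)

lemma pairing_cong:
  assumes "c \<in> combinations X" "\<And>x. x \<in> X \<Longrightarrow> f x = g x"
  shows "pairing c f = pairing c g"
  using assms unfolding pairing_def combinations_def by (intro sum.cong) auto

lemma pairing_add_right: "pairing c (\<lambda>x. f x + g x) = pairing c f + pairing c g"
  by (simp add: pairing_def sum.distrib distrib_left)

lemma pairing_diff_right: "pairing c (\<lambda>x. f x - g x) = pairing c f - pairing c g"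
  by (simp add: pairing_def sum_subtractf right_diff_distrib)

lemma pairing_mult_right: "pairing c (\<lambda>x. t * f x) = t * pairing c f"
  by (simp add: pairing_def sum_distrib_left mult.left_commute)

lemma pairing_scale_left: "pairing (t *\<^sub>R c) f = t * pairing c f"
  by (cases "t = 0") (simp_all add: pairing_def sum_distrib_left mult.assoc)

lemma pairing_add_left:
  assumes "c \<in> combinations X" "e \<in> combinations X"
  shows "pairing (c + e) f = pairing c f + pairing e f"
proof -
  define F where "F = {x. c x \<noteq> 0} \<union> {x. e x \<noteq> 0}"
  have "finite F" "{x. c x \<noteq> 0} \<subseteq> F" "{x. e x \<noteq> 0} \<subseteq> F" "{x. (c + e) x \<noteq> 0} \<subseteq> F"
    using assms by (auto simp: F_def combinations_def)
  then show ?thesis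
    by (simp add: pairing_superset[of F] sum.distrib distrib_right)
qed

lemma pairing_diff_left:
  assumes "c \<in> combinations X" "e \<in> combinations X"
  shows "pairing (c - e) f = pairing c f - pairing e f"
  using pairing_add_left[of "c - e" X e f] assms by auto

lemma pairing_fun_right:
  "pairing c (f + g) = pairing c f + pairing c g"
  "pairing c (f - g) = pairing c f - pairing c g"
  "pairing c (t *\<^sub>R f) = t * pairing c f"
  using pairing_add_right[of c f g] pairing_diff_right[of c f g] pairing_mult_right[of c t f]
  by (simp_all add: plus_fun_def fun_diff_def scaleR_fun_def)

lemma kernel_form_commute:
  assumes K: "kernel_on X K" and c: "c \<in> combinations X" and e: "e \<in> combinations X"
  shows "kernel_form K c e = kernel_form K e c"
proof -
  have "kernel_form K c e = (\<Sum>x | c x \<noteq> 0. \<Sum>y | e y \<noteq> 0. c x * (e y * K x y))"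
    by (simp add: kernel_form_def pairing_def sum_distrib_left)
  also have "\<dots> = (\<Sum>y | e y \<noteq> 0. \<Sum>x | c x \<noteq> 0. c x * (e y * K x y))"
    by (rule sum.swap)
  also have "\<dots> = (\<Sum>y | e y \<noteq> 0. \<Sum>x | c x \<noteq> 0. e y * (c x * K y x))"
    using K c e by (intro sum.cong) (auto simp: kernel_on_def combinations_def subset_iff)
  also have "\<dots> = kernel_form K e c"
    by (simp add: kernel_form_def pairing_def sum_distrib_left)
  finally show ?thesis .
qed

lemma kernel_form_add_left:
  "\<lbrakk>c \<in> combinations X; e \<in> combinations X\<rbrakk> \<Longrightarrow>
     kernel_form K (c + e) u = kernel_form K c u + kernel_form K e u"
  by (simp add: kernel_form_def pairing_add_left)

lemma kernel_form_diff_left: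
  "\<lbrakk>c \<in> combinations X; e \<in> combinations X\<rbrakk> \<Longrightarrow>
     kernel_form K (c - e) u = kernel_form K c u - kernel_form K e u"
  by (simp add: kernel_form_def pairing_diff_left)

lemma kernel_form_add_right:
  "\<lbrakk>c \<in> combinations X; e \<in> combinations X\<rbrakk> \<Longrightarrow>
     kernel_form K u (c + e) = kernel_form K u c + kernel_form K u e"
  by (simp add: kernel_form_def pairing_add_left pairing_add_right)

lemma kernel_form_diff_right:
  "\<lbrakk>c \<in> combinations X; e \<in> combinations X\<rbrakk> \<Longrightarrow>
     kernel_form K u (c - e) = kernel_form K u c - kernel_form K u e"
  by (simp add: kernel_form_def pairing_diff_left pairing_diff_right)

lemma kernel_form_scale:
  "kernel_form K (t *\<^sub>R c) u = t * kernel_form K c u"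
  "kernel_form K u (t *\<^sub>R c) = t * kernel_form K u c"
  by (simp_all add: kernel_form_def pairing_scale_left pairing_mult_right)

lemmas kernel_form_additive =
  kernel_form_add_left kernel_form_diff_left kernel_form_add_right kernel_form_diff_right

section \<open>The reproducing kernel Hilbert space of a positive semidefinite kernel\<close>

locale psd_kernel =
  fixes X :: "'a set" and K :: "'a \<Rightarrow> 'a \<Rightarrow> real"
  assumes symmetric: "kernel_on X K"
    and psd: "c \<in> combinations X \<Longrightarrow> 0 \<le> kernel_form K c c"
begin

text \<open>
  This is \<open>2\<langle>f,u\<rangle> - \<langle>u,u\<rangle>\<close> for the vector \<open>u\<close> that the combination \<open>c\<close> of kernel sections represents.
  For fixed \<open>f\<close> in an inner product space it is at most \<open>\<parallel>f\<parallel>\<^sup>2\<close>, with equality at \<open>u = f\<close>.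
\<close>
definition dual_value :: "('a \<Rightarrow> real) \<Rightarrow> ('a \<Rightarrow> real) \<Rightarrow> real" where
  "dual_value f c = 2 * pairing c f - kernel_form K c c"

text \<open>
  Functions vanish off \<open>X\<close> so that an element is determined by its values on \<open>X\<close>; otherwise the
  norm would not separate points.
\<close>
definition rkhs :: "('a \<Rightarrow> real) set" where
  "rkhs = {f. (\<forall>x. x \<notin> X \<longrightarrow> f x = 0) \<and> bdd_above (dual_value f ` combinations X)}"

definition sqnorm :: "('a \<Rightarrow> real) \<Rightarrow> real" where
  "sqnorm f = (SUP c\<in>combinations X. dual_value f c)"

lemma dual_value_le_sqnorm: "\<lbrakk>f \<in> rkhs; c \<in> combinations X\<rbrakk> \<Longrightarrow> dual_value f c \<le> sqnorm f"
  unfolding sqnorm_def rkhs_def by (intro cSUP_upper) auto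

lemma sqnorm_le: "(\<And>c. c \<in> combinations X \<Longrightarrow> dual_value f c \<le> q) \<Longrightarrow> sqnorm f \<le> q"
  unfolding sqnorm_def by (intro cSUP_least) auto

lemma rkhsI:
  assumes "\<And>x. x \<notin> X \<Longrightarrow> f x = 0" "\<And>c. c \<in> combinations X \<Longrightarrow> dual_value f c \<le> q"
  shows "f \<in> rkhs"
  using assms by (auto simp: rkhs_def intro!: bdd_aboveI2)

lemma rkhs_outside: "\<lbrakk>f \<in> rkhs; x \<notin> X\<rbrakk> \<Longrightarrow> f x = 0"
  by (simp add: rkhs_def)

lemma dual_value_scale: "dual_value (t *\<^sub>R f) (t *\<^sub>R c) = t\<^sup>2 * dual_value f c"
  by (simp add: dual_value_def pairing_scale_left pairing_fun_right kernel_form_scale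
      power2_eq_square algebra_simps)

lemma dual_value_parallelogram:
  assumes "c \<in> combinations X" "e \<in> combinations X"
  shows "dual_value (f + g) (c + e) + dual_value (f - g) (c - e) = 2 * dual_value f c + 2 * dual_value g e"
  using assms
  by (simp add: dual_value_def pairing_add_left[of _ X] pairing_diff_left[of _ X] pairing_fun_right
      kernel_form_additive[of _ X])

lemma sqnorm_zero: "0 \<in> rkhs" "sqnorm 0 = 0"
proof -
  have le: "dual_value 0 c \<le> 0" if "c \<in> combinations X" for c
    using psd[OF that] by (simp add: dual_value_def pairing_def)
  then show "0 \<in> rkhs" by (intro rkhsI) auto
  then have "dual_value 0 0 \<le> sqnorm 0" by (intro dual_value_le_sqnorm) auto
  then have "0 \<le> sqnorm 0" by (simp add: dual_value_def kernel_form_def pairing_def)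
  then show "sqnorm 0 = 0" using sqnorm_le[OF le] by simp
qed

text \<open>
  For \<open>t \<noteq> 0\<close>, \<open>c \<mapsto> t c\<close> is a bijection of the combinations over which the suprema are taken, and by
  \<open>dual_value_scale\<close> it multiplies the competing values by \<open>t\<^sup>2\<close>.
\<close>

lemma sqnorm_scale:
  assumes "f \<in> rkhs"
  shows "t *\<^sub>R f \<in> rkhs" "sqnorm (t *\<^sub>R f) = t\<^sup>2 * sqnorm f"
proof -
  have le: "dual_value (t *\<^sub>R f) c \<le> t\<^sup>2 * sqnorm f" if "f \<in> rkhs" "c \<in> combinations X" "t \<noteq> 0" for t f c
  proof -
    have "dual_value (t *\<^sub>R f) c = t\<^sup>2 * dual_value f (inverse t *\<^sub>R c)"
      using dual_value_scale[of t f "inverse t *\<^sub>R c"] that by simp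
    then show ?thesis
      using dual_value_le_sqnorm[of f "inverse t *\<^sub>R c"] that by (simp add: mult_left_mono)
  qed
  have mem: "t *\<^sub>R f \<in> rkhs" for t
    using assms sqnorm_zero(1) le[of f _ t]
    by (cases "t = 0") (auto intro!: rkhsI[where q = "t\<^sup>2 * sqnorm f"] simp: rkhs_outside)
  then show "t *\<^sub>R f \<in> rkhs" .
  show "sqnorm (t *\<^sub>R f) = t\<^sup>2 * sqnorm f"
  proof (cases "t = 0")
    case False
    \<comment> \<open>The reverse inequality is the first one for the inverse scalar.\<close>
    have "sqnorm f \<le> (inverse t)\<^sup>2 * sqnorm (t *\<^sub>R f)"
      using le[OF mem[of t], of _ "inverse t"] False by (intro sqnorm_le) simp
    then have "t\<^sup>2 * sqnorm f \<le> sqnorm (t *\<^sub>R f)"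
      using False by (simp add: power_inverse field_simps)
    moreover have "sqnorm (t *\<^sub>R f) \<le> t\<^sup>2 * sqnorm f"
      using assms False by (intro sqnorm_le le)
    ultimately show ?thesis by simp
  qed (simp add: sqnorm_zero)
qed

text \<open>
  Any two combinations \<open>c\<close>, \<open>e\<close> are the sum and the difference of their half sum and half difference,
  so the parallelogram identity for combinations bounds the values for \<open>f + g\<close> and \<open>f - g\<close>, with \<open>c\<close> and \<open>e\<close>
  chosen independently. Independence lets the two suprema be taken one after the other.
\<close>

lemma sqnorm_add_diff_le:
  assumes f: "f \<in> rkhs" and g: "g \<in> rkhs"
  shows "f + g \<in> rkhs" "f - g \<in> rkhs"
    "sqnorm (f + g) + sqnorm (f - g) \<le> 2 * sqnorm f + 2 * sqnorm g"
proof -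
  let ?q = "2 * sqnorm f + 2 * sqnorm g"
  have le: "dual_value (f + g) c + dual_value (f - g) e \<le> ?q"
    if "c \<in> combinations X" "e \<in> combinations X" for c e
  proof -
    let ?u = "(1/2) *\<^sub>R (c + e)" and ?v = "(1/2) *\<^sub>R (c - e)"
    have uv: "?u \<in> combinations X" "?v \<in> combinations X" using that by auto
    have "?u + ?v = c" "?u - ?v = e"
      by (simp_all add: fun_eq_iff field_simps)
    then have "dual_value (f + g) c + dual_value (f - g) e = 2 * dual_value f ?u + 2 * dual_value g ?v"
      using dual_value_parallelogram[OF uv, of f g] by simp
    then show ?thesis
      using dual_value_le_sqnorm[OF f uv(1)] dual_value_le_sqnorm[OF g uv(2)] by linarith
  qed
  have zero: "dual_value h 0 = 0" for h
    by (simp add: dual_value_def kernel_form_def pairing_def)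
  have "dual_value (f + g) c \<le> ?q" "dual_value (f - g) c \<le> ?q" if "c \<in> combinations X" for c
    using le[of c 0] le[of 0 c] that zero by auto
  then show mem: "f + g \<in> rkhs" "f - g \<in> rkhs"
    using f g by (auto intro!: rkhsI[where q = ?q] simp: rkhs_outside)
  have "sqnorm (f + g) \<le> ?q - sqnorm (f - g)"
  proof (rule sqnorm_le)
    fix c assume c: "c \<in> combinations X"
    have "sqnorm (f - g) \<le> ?q - dual_value (f + g) c"
      using le[OF c] by (intro sqnorm_le) (simp add: algebra_simps)
    then show "dual_value (f + g) c \<le> ?q - sqnorm (f - g)" by simp
  qed
  then show "sqnorm (f + g) + sqnorm (f - g) \<le> ?q" by simp
qed

lemma sqnorm_parallelogram:
  assumes f: "f \<in> rkhs" and g: "g \<in> rkhs"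
  shows "sqnorm (f + g) + sqnorm (f - g) = 2 * sqnorm f + 2 * sqnorm g"
proof (rule antisym)
  show "sqnorm (f + g) + sqnorm (f - g) \<le> 2 * sqnorm f + 2 * sqnorm g"
    by (rule sqnorm_add_diff_le(3)[OF assms])
  note mem = sqnorm_add_diff_le(1,2)[OF assms]
  \<comment> \<open>The opposite inequality is the same inequality for \<open>f + g\<close> and \<open>f - g\<close>.\<close>
  have "(f + g) + (f - g) = 2 *\<^sub>R f" "(f + g) - (f - g) = 2 *\<^sub>R g"
    by (simp_all add: fun_eq_iff)
  then show "2 * sqnorm f + 2 * sqnorm g \<le> sqnorm (f + g) + sqnorm (f - g)"
    using sqnorm_add_diff_le(3)[OF mem] sqnorm_scale(2)[OF f, of 2] sqnorm_scale(2)[OF g, of 2] by simp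
qed

lemma sqnorm_nonneg: "f \<in> rkhs \<Longrightarrow> 0 \<le> sqnorm f"
  using dual_value_le_sqnorm[of f 0] by (simp add: dual_value_def kernel_form_def pairing_def)

text \<open>
  Restricting the supremum to multiples \<open>t\<close> of one point mass gives \<open>2 t f(x) - t\<^sup>2 K(x,x) \<le> \<parallel>f\<parallel>\<^sup>2\<close>.
  The optimal \<open>t\<close> would yield the constant \<open>K x x\<close>; the summand 1 costs nothing in what follows and
  covers the case \<open>K x x = 0\<close> uniformly.
\<close>

lemma evaluation_bound:
  assumes f: "f \<in> rkhs" and x: "x \<in> X"
  shows "(f x)\<^sup>2 \<le> sqnorm f * (K x x + 1)"
proof -
  have K: "0 \<le> K x x"
    using psd[of "point_mass x"] x by (simp add: kernel_form_def)
  define t where "t = f x / (K x x + 1)"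
  have fx: "f x = t * (K x x + 1)" using K by (simp add: t_def)
  have "dual_value f (t *\<^sub>R point_mass x) \<le> sqnorm f"
    using x by (intro dual_value_le_sqnorm[OF f]) auto
  then have "2 * t * f x - t\<^sup>2 * K x x \<le> sqnorm f"
    by (simp add: dual_value_def pairing_scale_left kernel_form_scale)
       (simp add: kernel_form_def power2_eq_square mult.assoc)
  moreover have "t * f x = t\<^sup>2 * K x x + t\<^sup>2"
    unfolding fx by (simp add: power2_eq_square algebra_simps)
  ultimately have "t * f x \<le> sqnorm f"
    using zero_le_power2[of t] by linarith
  then have "t * f x * (K x x + 1) \<le> sqnorm f * (K x x + 1)"
    using K by (intro mult_right_mono) auto
  moreover have "t * f x * (K x x + 1) = (f x)\<^sup>2"
    unfolding fx by (simp add: power2_eq_square)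
  ultimately show ?thesis by simp
qed

sublocale parallelogram_space rkhs sqnorm
proof
  show "subspace rkhs"
    by (intro subspaceI sqnorm_zero sqnorm_scale sqnorm_add_diff_le)
  show "u = 0" if "u \<in> rkhs" "sqnorm u = 0" for u
  proof
    fix x
    show "u x = 0 x"
      using evaluation_bound[OF that(1), of x] rkhs_outside[OF that(1), of x] that(2)
      by (cases "x \<in> X") auto
  qed
qed (auto intro: sqnorm_nonneg sqnorm_scale sqnorm_parallelogram)

text \<open>
  Lower semicontinuity of the norm: a combination sees only finitely many values, so each
  competitor in the supremum passes to the pointwise limit.
\<close>

lemma sqnorm_closed_pointwise:
  assumes s: "\<And>n. s n \<in> rkhs" and outside: "\<And>x. x \<notin> X \<Longrightarrow> f x = 0"
    and lim: "\<And>x. x \<in> X \<Longrightarrow> (\<lambda>n. s n x) \<longlonglongrightarrow> f x"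
    and le: "\<And>n. n \<ge> m \<Longrightarrow> sqnorm (s n) \<le> q"
  shows "f \<in> rkhs" "sqnorm f \<le> q"
proof -
  have *: "dual_value f c \<le> q" if c: "c \<in> combinations X" for c
  proof (rule LIMSEQ_le_const2)
    show "(\<lambda>n. dual_value (s n) c) \<longlonglongrightarrow> dual_value f c"
      unfolding dual_value_def pairing_def using c
      by (intro tendsto_intros lim) (auto simp: combinations_def)
    show "\<exists>N. \<forall>n\<ge>N. dual_value (s n) c \<le> q"
      using dual_value_le_sqnorm[OF s c] le by (meson order_trans)
  qed
  show "f \<in> rkhs" using outside * by (rule rkhsI)
  show "sqnorm f \<le> q" using * by (rule sqnorm_le)
qed

text \<open>
  A Cauchy sequence converges pointwise by \<open>evaluation_bound\<close>. Applying
  \<open>sqnorm_closed_pointwise\<close> to the differences \<open>s n - s m\<close> as \<open>m\<close> tends to infinity shows both that the limit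
  belongs to the space and that the convergence is in norm.
\<close>

lemma real_hilbert_space_rkhs: "real_hilbert_space inner_structure"
proof -
  interpret real_inner_space inner_structure by (rule real_inner_space_inner_structure)
  interpret M: Metric_space rkhs "ip_dist inner_structure"
    using Metric_space_ip_dist by simp
  have "\<exists>f. limitin M.mtopology s f sequentially" if "M.MCauchy s" for s
  proof -
    have s: "s n \<in> rkhs" for n
      using that by (auto simp: M.MCauchy_def)
    have dist: "ip_dist inner_structure (s n) h = sqrt (sqnorm (s n - h))" if "h \<in> rkhs" for n h
      using ip_dist_inner_structure s that by blast
    have cauchy: "\<exists>N. \<forall>n\<ge>N. \<forall>m\<ge>N. sqnorm (s n - s m) < e" if "e > 0" for e
    proof -
      have "0 < sqrt e" using that by simp
      then obtain N where "\<And>n m. N \<le> n \<Longrightarrow> N \<le> m \<Longrightarrow> ip_dist inner_structure (s n) (s m) < sqrt e"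
        using \<open>M.MCauchy s\<close> unfolding M.MCauchy_def by blast
      then show ?thesis
        by (intro exI[of _ N]) (simp add: dist s)
    qed
    have "convergent (\<lambda>n. s n x)" if x: "x \<in> X" for x
    proof (rule Cauchy_convergent, rule metric_CauchyI)
      fix e :: real assume e: "0 < e"
      have K: "0 < K x x + 1"
        using psd[of "point_mass x"] x by (simp add: kernel_form_def)
      then obtain N where N: "\<And>n m. n \<ge> N \<Longrightarrow> m \<ge> N \<Longrightarrow> sqnorm (s n - s m) < e\<^sup>2 / (K x x + 1)"
        using cauchy[of "e\<^sup>2 / (K x x + 1)"] e by auto
      show "\<exists>N. \<forall>m\<ge>N. \<forall>n\<ge>N. dist (s m x) (s n x) < e"
      proof (intro exI allI impI)
        fix m n assume "N \<le> m" "N \<le> n"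
        have "(s m x - s n x)\<^sup>2 \<le> sqnorm (s m - s n) * (K x x + 1)"
          using evaluation_bound[of "s m - s n" x] x s by simp
        also have "\<dots> < e\<^sup>2"
          using N[OF \<open>N \<le> m\<close> \<open>N \<le> n\<close>] K by (simp add: pos_less_divide_eq)
        finally show "dist (s m x) (s n x) < e"
          using e power2_less_imp_less[of "\<bar>s m x - s n x\<bar>" e] by (simp add: dist_real_def)
      qed
    qed
    then have lim: "(\<lambda>n. s n x) \<longlonglongrightarrow> lim (\<lambda>n. s n x)" if "x \<in> X" for x
      using that convergent_LIMSEQ_iff by blast
    define f where "f x = (if x \<in> X then lim (\<lambda>n. s n x) else 0)" for x
    have diff: "s n - f \<in> rkhs" "sqnorm (s n - f) \<le> e"
      if "\<And>m. m \<ge> N \<Longrightarrow> sqnorm (s n - s m) \<le> e" for n N e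
    proof -
      have mem: "s n - s m \<in> rkhs" for m using s by auto
      have out: "(s n - f) x = 0" if "x \<notin> X" for x
        using that s[of n] by (simp add: f_def rkhs_outside)
      have tends: "(\<lambda>m. (s n - s m) x) \<longlonglongrightarrow> (s n - f) x" if "x \<in> X" for x
        using that lim[OF that] by (auto simp: f_def intro!: tendsto_intros)
      show "s n - f \<in> rkhs" "sqnorm (s n - f) \<le> e"
        using sqnorm_closed_pointwise[where s = "\<lambda>m. s n - s m" and f = "s n - f" and m = N and q = e,
            OF mem out tends that]
        by blast+
    qed
    obtain N where "\<forall>n\<ge>N. \<forall>m\<ge>N. sqnorm (s n - s m) < 1"
      using cauchy[of 1] by auto
    then have "s N - f \<in> rkhs" using diff(1)[of N N 1] by force
    then have f: "f \<in> rkhs" using subspace_diff[OF V s[of N], of "s N - f"] by simp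
    have "\<exists>N. \<forall>n\<ge>N. ip_dist inner_structure (s n) f < e" if e: "e > 0" for e
    proof -
      have "0 < (e/2)\<^sup>2" using e by simp
      then obtain N where N: "\<And>n m. n \<ge> N \<Longrightarrow> m \<ge> N \<Longrightarrow> sqnorm (s n - s m) < (e/2)\<^sup>2"
        using cauchy by blast
      have "ip_dist inner_structure (s n) f < e" if n: "n \<ge> N" for n
      proof -
        have "sqnorm (s n - f) \<le> (e/2)\<^sup>2"
          using N[OF n] by (intro diff(2)[of N]) (simp add: less_imp_le)
        then have "ip_dist inner_structure (s n) f \<le> e/2"
          unfolding dist[OF f] using e by (intro real_le_lsqrt) simp_all
        then show ?thesis using e by linarith
      qed
      then show ?thesis by blast
    qed
    then have "limitin M.mtopology s f sequentially"
      using f s by (simp add: M.limit_metric_sequentially)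
    then show ?thesis by (rule exI[of _ f])
  qed
  then show ?thesis
    by (simp add: real_hilbert_space_def real_hilbert_space_axioms_def
        real_inner_space_inner_structure M.mcomplete_def)
qed

text \<open>
  For a combination \<open>u\<close> of points \<open>x\<^sub>i\<close>, this is the vector \<open>\<Sum> u\<^sub>i K(x\<^sub>i,-)\<close> that \<open>u\<close> represents. The name
  is that of potential theory, with \<open>u\<close> as a charge distribution.
\<close>
definition potential :: "('a \<Rightarrow> real) \<Rightarrow> 'a \<Rightarrow> real" where
  "potential u = (\<lambda>x. if x \<in> X then pairing u (K x) else 0)"

text \<open>
  Positivity of the form at \<open>c - u\<close> is precisely the statement that the supremum defining the norm is
  attained at \<open>c = u\<close>.
\<close>

lemma sqnorm_potential:
  assumes u: "u \<in> combinations X"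
  shows "potential u \<in> rkhs" "sqnorm (potential u) = kernel_form K u u"
proof -
  have pair: "pairing c (potential u) = kernel_form K c u" if "c \<in> combinations X" for c
    unfolding kernel_form_def potential_def using that by (rule pairing_cong) simp
  have le: "dual_value (potential u) c \<le> kernel_form K u u" if c: "c \<in> combinations X" for c
  proof -
    have "0 \<le> kernel_form K (c - u) (c - u)" using u c by (intro psd) auto
    then show ?thesis
      using u c kernel_form_commute[OF symmetric u c]
      by (simp add: dual_value_def pair kernel_form_additive[of _ X])
  qed
  show mem: "potential u \<in> rkhs"
    using le by (intro rkhsI) (auto simp: potential_def)
  have "dual_value (potential u) u = kernel_form K u u"
    by (simp add: dual_value_def pair u)
  then show "sqnorm (potential u) = kernel_form K u u"
    using dual_value_le_sqnorm[OF mem u] sqnorm_le[OF le] by simp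
qed

lemma ip_dist_sections:
  assumes x: "x \<in> X" and y: "y \<in> X"
  shows "ip_dist inner_structure (potential (point_mass x)) (potential (point_mass y)) =
    sqrt (K x x + K y y - 2 * K x y)"
proof -
  let ?u = "point_mass x - point_mass y"
  have mem: "potential (point_mass x) \<in> rkhs" "potential (point_mass y) \<in> rkhs"
    using x y by (simp_all add: sqnorm_potential)
  have "potential (point_mass x) - potential (point_mass y) = potential ?u"
    using x y by (simp add: potential_def fun_eq_iff pairing_diff_left[of _ X])
  moreover have "sqnorm (potential ?u) = K x x + K y y - 2 * K x y"
    using x y symmetric
    by (simp add: sqnorm_potential kernel_form_additive[of _ X])
       (simp add: kernel_form_def kernel_on_def)
  ultimately show ?thesis
    by (simp add: ip_dist_inner_structure[OF mem])
qed

end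

section \<open>Negative definite kernels and squared distances\<close>

text \<open>
  Passage from sequences of points, possibly with repetitions, to coefficient functions: enumerate
  the support.
\<close>

lemma negative_definite_kernel_form:
  assumes N: "negative_definite_kernel X N" and c: "c \<in> combinations X"
    and zero: "pairing c (\<lambda>_. 1) = 0"
  shows "kernel_form N c c \<le> 0"
proof -
  define F where "F = {x. c x \<noteq> 0}"
  have "finite F" "F \<subseteq> X" using c by (auto simp: F_def combinations_def)
  then obtain g where g: "bij_betw g {..<card F} F"
    using ex_bij_betw_nat_finite[of F] by (auto simp: atLeast0LessThan)
  have re: "pairing c f = (\<Sum>i<card F. c (g i) * f (g i))" for f
    unfolding pairing_def F_def[symmetric]
    using sum.reindex_bij_betw[OF g, of "\<lambda>x. c x * f x"] by simp
  have "g \<in> {..<card F} \<rightarrow> X"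
    using g \<open>F \<subseteq> X\<close> by (auto simp: bij_betw_def)
  moreover have "(\<Sum>i<card F. c (g i)) = 0" using zero by (simp add: re)
  ultimately have "(\<Sum>i<card F. \<Sum>j<card F. N (g i) (g j) * c (g i) * c (g j)) \<le> 0"
    using N[unfolded negative_definite_kernel_def, THEN conjunct2, rule_format,
        of g "card F" "\<lambda>i. c (g i)"] by simp
  then show ?thesis
    by (simp add: kernel_form_def re sum_distrib_left mult_ac)
qed

text \<open>
  Schoenberg's correspondence. Placing the mass \<open>-m\<close> at the base point, where \<open>m\<close> is the total mass of \<open>c\<close>,
  gives a combination \<open>e\<close> of total mass zero, and the form of \<open>K\<close> at \<open>c\<close> is \<open>-1/2\<close> times that of \<open>N\<close> at \<open>e\<close>.
  Normalization enters through \<open>N p p = 0\<close>.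
\<close>

lemma psd_kernel_of_negative_definite:
  assumes N: "negative_definite_kernel X N" and norm: "normalized_kernel X N" and p: "p \<in> X"
  shows "psd_kernel X (\<lambda>x y. (N x p + N p y - N x y) / 2)" (is "psd_kernel X ?K")
proof
  have sym: "kernel_on X N" using N by (simp add: negative_definite_kernel_def)
  then show "kernel_on X ?K"
    using p by (auto simp: kernel_on_def)
  fix c assume c: "c \<in> combinations X"
  define m where "m = pairing c (\<lambda>_. 1)"
  let ?e = "c - m *\<^sub>R point_mass p"
  have e: "?e \<in> combinations X" using c p by auto
  have inner: "pairing c (?K x) = (N x p * m + pairing c (N p) - pairing c (N x)) / 2" for x
    using pairing_mult_right[of c "1/2" "\<lambda>y. N x p + N p y - N x y"]
      pairing_mult_right[of c "N x p" "\<lambda>_. 1"]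
    by (simp add: pairing_add_right pairing_diff_right m_def)
  have lin: "kernel_form ?K c c =
      (m * pairing c (\<lambda>x. N x p) + m * pairing c (N p) - kernel_form N c c) / 2"
    unfolding kernel_form_def inner
    using pairing_mult_right[of c "1/2" "\<lambda>x. N x p * m + pairing c (N p) - pairing c (N x)"]
      pairing_mult_right[of c m "\<lambda>x. N x p"] pairing_mult_right[of c "pairing c (N p)" "\<lambda>_. 1"]
    by (simp add: pairing_add_right pairing_diff_right m_def mult.commute)
  have "pairing ?e (\<lambda>_. 1) = 0"
    using c p by (simp add: pairing_diff_left[of _ X] pairing_scale_left m_def)
  then have "kernel_form N ?e ?e \<le> 0"
    by (rule negative_definite_kernel_form[OF N e])
  moreover have "kernel_form N ?e ?e =
      kernel_form N c c - m * pairing c (\<lambda>x. N x p) - m * pairing c (N p)"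
    using c p norm
    by (simp add: kernel_form_additive[of _ X] kernel_form_scale) (simp add: kernel_form_def normalized_kernel_def)
  ultimately show "0 \<le> kernel_form ?K c c" by (simp add: lin)
qed

theorem negative_definite_kernel_embeds:
  fixes N :: "'a \<Rightarrow> 'a \<Rightarrow> real"
  assumes N: "negative_definite_kernel X N" and norm: "normalized_kernel X N"
  obtains H :: "('a \<Rightarrow> real) inner_space" and f
  where "real_hilbert_space H" "f \<in> X \<rightarrow> carrier H"
    "\<And>x y. x \<in> X \<Longrightarrow> y \<in> X \<Longrightarrow> ip_dist H (f x) (f y) = sqrt (N x y)"
proof -
  have "\<exists>K. psd_kernel X K \<and> (\<forall>x\<in>X. \<forall>y\<in>X. K x x + K y y - 2 * K x y = N x y)"
  proof (cases "X = {}")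
    case True
    then have "psd_kernel X N"
      by unfold_locales (auto simp: kernel_on_def combinations_def kernel_form_def pairing_def)
    with True show ?thesis by blast
  next
    case False
    then obtain p where p: "p \<in> X" by blast
    let ?K = "\<lambda>x y. (N x p + N p y - N x y) / 2"
    have "?K x x + ?K y y - 2 * ?K x y = N x y" if "x \<in> X" "y \<in> X" for x y
    proof -
      have "N p x = N x p" "N p y = N y p"
        using N that p unfolding negative_definite_kernel_def kernel_on_def by blast+
      moreover have "N x x = 0" "N y y = 0"
        using norm that by (simp_all add: normalized_kernel_def)
      ultimately show ?thesis by (simp add: field_simps)
    qed
    then show ?thesis
      using psd_kernel_of_negative_definite[OF N norm p] by (intro exI[of _ ?K]) simp
  qed
  then obtain K where "psd_kernel X K" and K: "\<And>x y. x \<in> X \<Longrightarrow> y \<in> X \<Longrightarrow> K x x + K y y - 2 * K x y = N x y"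
    by blast
  interpret psd_kernel X K by fact
  show thesis
    by (rule that[of inner_structure "\<lambda>x. potential (point_mass x)"])
       (auto simp: real_hilbert_space_rkhs sqnorm_potential ip_dist_sections K)
qed

context real_inner_space
begin

text \<open>
  The vector \<open>\<Sum> c\<^sub>i v\<^sub>i\<close>, described by its inner products only; this is all that the computation of
  \<open>negative_definite_squared_distance\<close> needs.
\<close>

lemma linear_combination_exists:
  fixes n :: nat
  assumes "\<And>i. i < n \<Longrightarrow> v i \<in> carrier H"
  shows "\<exists>s\<in>carrier H. \<forall>z\<in>carrier H. ip H s z = (\<Sum>i<n. c i * ip H (v i) z)"
  using assms
proof (induction n)
  case 0
  then show ?case by (intro bexI[of _ \<zero>]) auto
next
  case (Suc n)
  then obtain s where "s \<in> carrier H" "\<forall>z\<in>carrier H. ip H s z = (\<Sum>i<n. c i * ip H (v i) z)"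
    by force
  with Suc.prems show ?case
    by (intro bexI[of _ "s \<oplus> c n \<odot> v n"]) (auto simp: ip_add_left ip_smult_left)
qed

lemma ip_dist_squared:
  assumes "x \<in> carrier H" "y \<in> carrier H"
  shows "(ip_dist H x y)\<^sup>2 = ip H x x + ip H y y - 2 * ip H x y"
  using assms ip_neg_neg[of y] ip_commute[of x y] ip_commute[of x "\<ominus> y"]
  by (simp add: ip_dist_def ip_nonneg)
     (simp add: a_minus_def ip_add_left ip_add_right ip_neg_left)

lemma negative_definite_squared_distance:
  fixes X :: "'x set"
  assumes f: "f \<in> X \<rightarrow> carrier H"
  shows "negative_definite_kernel X (\<lambda>x y. (ip_dist H (f x) (f y))\<^sup>2)"
    "normalized_kernel X (\<lambda>x y. (ip_dist H (f x) (f y))\<^sup>2)"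
proof -
  interpret M: Metric_space "carrier H" "ip_dist H" by (rule Metric_space_ip_dist)
  show "normalized_kernel X (\<lambda>x y. (ip_dist H (f x) (f y))\<^sup>2)"
    using M.zero funcset_mem[OF f] by (simp add: normalized_kernel_def)
  have "(\<Sum>i<n. \<Sum>j<n. (ip_dist H (f (x i)) (f (x j)))\<^sup>2 * c i * c j) \<le> 0"
    if x: "x \<in> {..<n} \<rightarrow> X" and c: "(\<Sum>i<n. c i) = 0" for n and x :: "nat \<Rightarrow> 'x" and c :: "nat \<Rightarrow> real"
  proof -
    define v where "v i = f (x i)" for i
    define q where "q i = ip H (v i) (v i)" for i
    have v: "v i \<in> carrier H" if "i < n" for i
      using that x f by (auto simp: v_def)
    obtain s where s: "s \<in> carrier H"
      and s_ip: "\<And>z. z \<in> carrier H \<Longrightarrow> ip H s z = (\<Sum>i<n. c i * ip H (v i) z)"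
      using linear_combination_exists[of n v c] v by blast
    have "ip H s s = (\<Sum>i<n. c i * ip H (v i) s)" by (rule s_ip[OF s])
    also have "\<dots> = (\<Sum>i<n. c i * (\<Sum>j<n. c j * ip H (v i) (v j)))"
      using v s by (intro sum.cong) (auto simp: ip_commute[of _ s] s_ip ip_commute)
    finally have ss: "ip H s s = (\<Sum>i<n. \<Sum>j<n. c i * (c j * ip H (v i) (v j)))"
      by (simp add: sum_distrib_left)
    \<comment> \<open>The first two groups of terms contain the factor \<open>\<Sum> c\<^sub>i = 0\<close>.\<close>
    have "(\<Sum>i<n. \<Sum>j<n. (ip_dist H (f (x i)) (f (x j)))\<^sup>2 * c i * c j)
        = (\<Sum>i<n. \<Sum>j<n. (c i * q i) * c j + c i * (c j * q j) - 2 * (c i * (c j * ip H (v i) (v j))))"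
      using v by (intro sum.cong) (auto simp: ip_dist_squared q_def algebra_simps simp flip: v_def)
    also have "\<dots> = (\<Sum>i<n. c i * q i) * (\<Sum>j<n. c j) + (\<Sum>i<n. c i) * (\<Sum>j<n. c j * q j) - 2 * ip H s s"
      by (simp only: ss sum_product sum.distrib sum_subtractf sum_distrib_left[where r = 2])
    also have "\<dots> \<le> 0" using c ip_nonneg[OF s] by simp
    finally show ?thesis .
  qed
  then show "negative_definite_kernel X (\<lambda>x y. (ip_dist H (f x) (f y))\<^sup>2)"
    by (auto simp: negative_definite_kernel_def kernel_on_def M.commute)
qed

end

section \<open>Coarse embeddings into Hilbert spaces\<close>

lemma control_function_power2: "control_function \<rho> \<Longrightarrow> control_function (\<lambda>t. (\<rho> t)\<^sup>2)"
  by (simp add: control_function_def mono_on_def Pi_iff power_mono)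

lemma control_function_sqrt: "control_function \<rho> \<Longrightarrow> control_function (\<lambda>t. sqrt (\<rho> t))"
  by (simp add: control_function_def mono_on_def Pi_iff)

definition kernel_controlled_by :: "'a set \<Rightarrow> ('a \<Rightarrow> 'a \<Rightarrow> real) \<Rightarrow> bool" where
  "kernel_controlled_by X d \<longleftrightarrow>
    (\<exists>(N :: 'a \<Rightarrow> 'a \<Rightarrow> real) \<rho>1 \<rho>2.
       negative_definite_kernel X N \<and> normalized_kernel X N \<and>
       control_function \<rho>1 \<and> control_function \<rho>2 \<and>
       (\<forall>x\<in>X. \<forall>y\<in>X. \<rho>1 (d x y) \<le> N x y \<and> N x y \<le> \<rho>2 (d x y)) \<and>
       filterlim \<rho>1 at_top at_top)"

lemma coarse_embedding_imp_kernel: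
  assumes d: "Metric_space X d" and emb: "coarsely_embeds_in_hilbert TYPE('h) X d"
  shows "kernel_controlled_by X d"
proof -
  obtain H :: "'h inner_space" and f \<sigma>1 \<sigma>2 where H: "real_hilbert_space H" and f: "f \<in> X \<rightarrow> carrier H"
    and \<sigma>: "control_function \<sigma>1" "control_function \<sigma>2"
    and bounds: "\<forall>x\<in>X. \<forall>y\<in>X. \<sigma>1 (d x y) \<le> ip_dist H (f x) (f y) \<and> ip_dist H (f x) (f y) \<le> \<sigma>2 (d x y)"
    and lim: "filterlim \<sigma>1 at_top at_top"
    using emb unfolding coarsely_embeds_in_hilbert_def coarse_embedding_def by blast
  interpret real_hilbert_space H by (rule H)
  interpret M: Metric_space "carrier H" "ip_dist H" by (rule Metric_space_ip_dist)
  interpret D: Metric_space X d by (rule d)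
  have "0 \<le> \<sigma>1 (d x y)" for x y
    using \<sigma>(1) D.nonneg[of x y] by (simp add: control_function_def Pi_iff)
  then have "\<forall>x\<in>X. \<forall>y\<in>X. (\<sigma>1 (d x y))\<^sup>2 \<le> (ip_dist H (f x) (f y))\<^sup>2 \<and>
      (ip_dist H (f x) (f y))\<^sup>2 \<le> (\<sigma>2 (d x y))\<^sup>2"
    using bounds M.nonneg by (simp add: power_mono)
  moreover have "filterlim (\<lambda>t. (\<sigma>1 t)\<^sup>2) at_top at_top"
    by (rule filterlim_pow_at_top[OF _ lim]) simp
  ultimately show ?thesis
    unfolding kernel_controlled_by_def
    using negative_definite_squared_distance[OF f] \<sigma>[THEN control_function_power2]
    by (intro exI[of _ "\<lambda>x y. (ip_dist H (f x) (f y))\<^sup>2"] exI[of _ "\<lambda>t. (\<sigma>1 t)\<^sup>2"]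
        exI[of _ "\<lambda>t. (\<sigma>2 t)\<^sup>2"]) simp
qed

lemma kernel_imp_coarse_embedding:
  fixes X :: "'a set"
  assumes "kernel_controlled_by X d"
  shows "coarsely_embeds_in_hilbert TYPE('a \<Rightarrow> real) X d"
proof -
  obtain N :: "'a \<Rightarrow> 'a \<Rightarrow> real" and \<rho>1 \<rho>2
    where N: "negative_definite_kernel X N" "normalized_kernel X N"
    and \<rho>: "control_function \<rho>1" "control_function \<rho>2"
    and bounds: "\<forall>x\<in>X. \<forall>y\<in>X. \<rho>1 (d x y) \<le> N x y \<and> N x y \<le> \<rho>2 (d x y)"
    and lim: "filterlim \<rho>1 at_top at_top"
    using assms unfolding kernel_controlled_by_def by blast
  obtain H :: "('a \<Rightarrow> real) inner_space" and f where H: "real_hilbert_space H" "f \<in> X \<rightarrow> carrier H"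
    and dist: "\<And>x y. x \<in> X \<Longrightarrow> y \<in> X \<Longrightarrow> ip_dist H (f x) (f y) = sqrt (N x y)"
    using negative_definite_kernel_embeds[OF N] by blast
  have "filterlim (\<lambda>t. sqrt (\<rho>1 t)) at_top at_top"
    by (rule filterlim_compose[OF sqrt_at_top lim])
  then have "coarse_embedding X d (carrier H) (ip_dist H) f"
    unfolding coarse_embedding_def using H(2) \<rho>[THEN control_function_sqrt] bounds
    by (intro conjI exI[of _ "\<lambda>t. sqrt (\<rho>1 t)"] exI[of _ "\<lambda>t. sqrt (\<rho>2 t)"]) (auto simp: dist)
  then show ?thesis
    unfolding coarsely_embeds_in_hilbert_def using H(1) by blast
qed

theorem proposition3p1:
  fixes X :: "'a set" and d :: "'a \<Rightarrow> 'a \<Rightarrow> real"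
  assumes "Metric_space X d"
  shows "(coarsely_embeds_in_hilbert TYPE('a \<Rightarrow> real) X d \<longleftrightarrow>
            (\<exists>(N :: 'a \<Rightarrow> 'a \<Rightarrow> real) \<rho>1 \<rho>2.
               negative_definite_kernel X N \<and> normalized_kernel X N \<and>
               control_function \<rho>1 \<and> control_function \<rho>2 \<and>
               (\<forall>x\<in>X. \<forall>y\<in>X. \<rho>1 (d x y) \<le> N x y \<and> N x y \<le> \<rho>2 (d x y)) \<and>
               filterlim \<rho>1 at_top at_top))
       \<and> (coarsely_embeds_in_hilbert TYPE('h) X d \<longrightarrow>
            coarsely_embeds_in_hilbert TYPE('a \<Rightarrow> real) X d)"
  unfolding kernel_controlled_by_def[symmetric]
  using coarse_embedding_imp_kernel[OF assms, where ?'h = "'a \<Rightarrow> real"]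
    coarse_embedding_imp_kernel[OF assms, where ?'h = 'h] kernel_imp_coarse_embedding[of X d]
  by blast

end
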